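(* Let $(\mathfrak{g},\mathfrak{T})$ be a $\lambda$-weighted Rota-Baxter Lie algebra with Lie bracket $\mu$. If $H^2_{\mathsf{RB}}(\mathfrak{g},\mathfrak{g})=0$, then any formal $1$-parameter deformation of $(\mathfrak{g},\mathfrak{T})$ is equivalent to the trivial one $(\mu_t'=\mu,\ \mathfrak{T}_t'=\mathfrak{T})$.
   Context: All vector spaces and (multi)linear maps are over a field $\mathbf{k}$ of characteristic $0$; $\lambda\in\mathbf{k}$ is a fixed scalar. A $\lambda$-weighted Rota-Baxter Lie algebra is a pair $(\mathfrak{g},\mathfrak{T})$ of a Lie algebra $\mathfrak{g}$ and a $\lambda$-weighted Rota-Baxter operator on it, i.e. a linear map $\mathfrak{T}:\mathfrak{g}\to\mathfrak{g}$ with $[\mathfrak{T}(x),\mathfrak{T}(y)]=\mathfrak{T}([\mathfrak{T}(x),y]+[x,\mathfrak{T}(y)]+\lambda[x,y])$ for all $x,y\in\mathfrak{g}$. A morphism $(\mathfrak{g},\mathfrak{T})\to(\mathfrak{g}',\mathfrak{T}')$ is a Lie algebra homomorphism $\phi$ with $\phi\circ\mathfrak{T}=\mathfrak{T}'\circ\phi$. The adjoint representation of $(\mathfrak{g},\mathfrak{T})$ is $\mathfrak{g}$ with action $\rho(x)y=[x,y]$ together with the operator $\mathfrak{T}$; $H^*_{\mathsf{RB}}(\mathfrak{g},\mathfrak{g})$ is the cohomology with coefficients in it, defined as follows. **Cohomology with coefficients in the adjoint representation.** Put $[x,y]_{\mathfrak{T}}=[\mathfrak{T}(x),y]+[x,\mathfrak{T}(y)]+\lambda[x,y]$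 and $\widetilde{\rho}(x)y=[\mathfrak{T}(x),y]-\mathfrak{T}([x,y])$; then $(\mathfrak{g},[\,,]_{\mathfrak{T}})$ is a Lie algebra represented on $\mathfrak{g}$ by $\widetilde{\rho}$. For $f\in\mathrm{Hom}(\wedge^n\mathfrak{g},\mathfrak{g})$ let $$(\delta_{\mathsf{CE}}f)(x_1,\ldots,x_{n+1})=\sum_{i=1}^{n+1}(-1)^{i+n}\rho(x_i)f(x_1,\ldots,\widehat{x_i},\ldots,x_{n+1})+\sum_{1\le i<j\le n+1}(-1)^{i+j+n+1}f([x_i,x_j],x_1,\ldots,\widehat{x_i},\ldots,\widehat{x_j},\ldots,x_{n+1}),$$ and let $\partial_{\mathsf{CE}}$ be given by the same formula with $\rho$ replaced by $\widetilde{\rho}$ and $[\,,]$ replaced by $[\,,]_{\mathfrak{T}}$. Let $\Phi^0=\mathrm{id}_{\mathfrak{g}}$ and, for $n\ge1$, $$\Phi^n(f)(x_1,\ldots,x_n)=f(\mathfrak{T}(x_1),\ldots,\mathfrak{T}(x_n))-\sum_{k=0}^{n-1}\lambda^{n-k-1}\sum_{i_1<\cdots<i_k}\mathfrak{T}\big(f(x_1,\ldots,\mathfrak{T}(x_{i_1}),\ldots,\mathfrak{T}(x_{i_k}),\ldots,x_n)\big),$$ where in the inner sum $\mathfrak{T}$ is applied exactly to the entries in positions $i_1,\ldots,i_k$. Set $C^0_{\mathsf{RB}}(\mathfrak{g},\mathfrak{g})=\mathfrak{g}$ and $C^n_{\mathsf{RB}}(\mathfrak{g},\mathfrak{g})=\mathrm{Hom}(\wedge^n\mathfrak{g},\mathfrak{g})\oplus\mathrm{Hom}(\wedge^{n-1}\mathfrak{g},\mathfrak{g})$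 for $n\ge1$, with $\delta_{\mathsf{RB}}(v)=(\delta_{\mathsf{CE}}(v),-v)$ and $\delta_{\mathsf{RB}}(f,g)=(\delta_{\mathsf{CE}}(f),-\partial_{\mathsf{CE}}(g)-\Phi^n(f))$. This is a cochain complex, with cohomology $H^n_{\mathsf{RB}}(\mathfrak{g},\mathfrak{g})$. **Deformations.** Let $\mu\in\mathrm{Hom}(\wedge^2\mathfrak{g},\mathfrak{g})$ be the Lie bracket of $\mathfrak{g}$. A formal $1$-parameter deformation of $(\mathfrak{g},\mathfrak{T})$ is a pair of formal power series $\mu_t=\sum_{i\ge0}\mu_it^i$ with $\mu_i\in\mathrm{Hom}(\wedge^2\mathfrak{g},\mathfrak{g})$, $\mu_0=\mu$, and $\mathfrak{T}_t=\sum_{i\ge0}\mathfrak{T}_it^i$ with $\mathfrak{T}_i\in\mathrm{Hom}(\mathfrak{g},\mathfrak{g})$, $\mathfrak{T}_0=\mathfrak{T}$, such that the $\mathbf{k}[[t]]$-bilinear map $\mu_t$ is a Lie bracket on $\mathfrak{g}[[t]]$ and the $\mathbf{k}[[t]]$-linear map $\mathfrak{T}_t$ is a $\lambda$-weighted Rota-Baxter operator on $(\mathfrak{g}[[t]],\mu_t)$. Two deformations $(\mu_t,\mathfrak{T}_t)$ and $(\mu_t',\mathfrak{T}_t')$ are equivalent if there is $\phi_t=\sum_{i\ge0}\phi_it^i:\mathfrak{g}[[t]]\to\mathfrak{g}[[t]]$ with $\phi_i\in\mathrm{Hom}(\mathfrak{g},\mathfrak{g})$, $\phi_0=\mathrm{id}_{\mathfrak{g}}$,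 such that the $\mathbf{k}[[t]]$-linear map $\phi_t$ is a morphism of $\lambda$-weighted Rota-Baxter Lie algebras from $((\mathfrak{g}[[t]],\mu_t'),\mathfrak{T}_t')$ to $((\mathfrak{g}[[t]],\mu_t),\mathfrak{T}_t)$. *)

theory Defs
  imports
    "HOL-Computational_Algebra.Formal_Power_Series"
    "HOL-Library.Function_Algebras"
    "HOL-Library.Product_Plus"
begin

section \<open>Rota-Baxter Lie algebras\<close>

text \<open>
  Everything is stated over a commutative ring, since it is used both for a vector space over a
  field \<open>k\<close> and for a \<open>k[[t]]\<close>-module of power series.
\<close>

definition alternating_bilinear ::
  "('r::comm_ring_1 \<Rightarrow> 'a::ab_group_add \<Rightarrow> 'a) \<Rightarrow> ('a \<Rightarrow> 'a \<Rightarrow> 'a) \<Rightarrow> bool" where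
  "alternating_bilinear scale b \<longleftrightarrow>
     (\<forall>x. module_hom scale scale (\<lambda>y. b x y)) \<and>
     (\<forall>y. module_hom scale scale (\<lambda>x. b x y)) \<and>
     (\<forall>x. b x x = 0)"

locale lie_algebra = module scale
  for scale :: "'r::comm_ring_1 \<Rightarrow> 'a::ab_group_add \<Rightarrow> 'a" +
  fixes br :: "'a \<Rightarrow> 'a \<Rightarrow> 'a"
  assumes alternating_bilinear: "alternating_bilinear scale br"
    and jacobi: "br x (br y z) + br y (br z x) + br z (br x y) = 0"

locale rb_lie_algebra = lie_algebra scale br
  for scale :: "'r::comm_ring_1 \<Rightarrow> 'a::ab_group_add \<Rightarrow> 'a" and br :: "'a \<Rightarrow> 'a \<Rightarrow> 'a" +
  fixes lam :: 'r and T :: "'a \<Rightarrow> 'a"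
  assumes linear_T: "module_hom scale scale T"
    and rota_baxter: "br (T x) (T y) = T (br (T x) y + br x (T y) + scale lam (br x y))"

locale rb_lie_algebra_morphism =
  source: rb_lie_algebra scale br lam T + target: rb_lie_algebra scale' br' lam T'
  for scale :: "'r::comm_ring_1 \<Rightarrow> 'a::ab_group_add \<Rightarrow> 'a"
    and scale' :: "'r \<Rightarrow> 'b::ab_group_add \<Rightarrow> 'b"
    and lam :: 'r
    and br :: "'a \<Rightarrow> 'a \<Rightarrow> 'a" and T :: "'a \<Rightarrow> 'a"
    and br' :: "'b \<Rightarrow> 'b \<Rightarrow> 'b" and T' :: "'b \<Rightarrow> 'b" +
  fixes phi :: "'a \<Rightarrow> 'b"
  assumes linear_phi: "module_hom scale scale' phi"
    and phi_bracket: "phi (br x y) = br' (phi x) (phi y)"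
    and phi_operator: "phi \<circ> T = T' \<circ> phi"

section \<open>Cohomology with coefficients in the adjoint representation\<close>

text \<open>
  An element of \<open>Hom(\<And>\<^sup>n g, g)\<close> is an alternating \<open>n\<close>-linear map, taken as a function on the list
  of its arguments that is \<open>0\<close> on all lists of length other than \<open>n\<close>. Thus equal cochains are
  equal as functions, and \<open>Hom(\<And>\<^sup>0 g, g)\<close> is \<open>g\<close> via \<open>f \<mapsto> f []\<close>.
\<close>

definition alternating_maps ::
  "('r::comm_ring_1 \<Rightarrow> 'a::ab_group_add \<Rightarrow> 'a) \<Rightarrow> nat \<Rightarrow> ('a list \<Rightarrow> 'a) set" where
  "alternating_maps scale n = {f.
     (\<forall>xs. length xs \<noteq> n \<longrightarrow> f xs = 0) \<and>
     (\<forall>xs i. length xs = n \<and> i < n \<longrightarrow> module_hom scale scale (\<lambda>x. f (xs[i := x]))) \<and>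
     (\<forall>xs i j. length xs = n \<and> i < j \<and> j < n \<and> xs ! i = xs ! j \<longrightarrow> f xs = 0)}"

text \<open>
  The Chevalley-Eilenberg differential in degree \<open>n\<close> for a bracket \<open>br\<close> acting through \<open>rho\<close>.
  Positions are counted from \<open>0\<close>, so the usual signs \<open>(-1)\<^bsup>i+n\<^esup>\<close> and \<open>(-1)\<^bsup>i+j+n+1\<^esup>\<close> of the
  one-based indices become \<open>(-1)\<^bsup>i+n+1\<^esup>\<close> and \<open>(-1)\<^bsup>i+j+n+1\<^esup>\<close>; \<open>nths xs (- I)\<close> omits the entries
  at the positions in \<open>I\<close>.
\<close>

definition ce_differential ::
  "('r::comm_ring_1 \<Rightarrow> 'a::ab_group_add \<Rightarrow> 'a) \<Rightarrow> ('a \<Rightarrow> 'a \<Rightarrow> 'a) \<Rightarrow> ('a \<Rightarrow> 'a \<Rightarrow> 'a) \<Rightarrow>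
    nat \<Rightarrow> ('a list \<Rightarrow> 'a) \<Rightarrow> 'a list \<Rightarrow> 'a" where
  "ce_differential scale rho br n f xs =
     (if length xs = n + 1 then
        (\<Sum>i<n+1. scale ((-1) ^ (i + n + 1)) (rho (xs ! i) (f (nths xs (- {i})))))
        + (\<Sum>j<n+1. \<Sum>i<j. scale ((-1) ^ (i + j + n + 1))
             (f (br (xs ! i) (xs ! j) # nths xs (- {i, j}))))
      else 0)"

definition descendant_bracket ::
  "('r::comm_ring_1 \<Rightarrow> 'a::ab_group_add \<Rightarrow> 'a) \<Rightarrow> ('a \<Rightarrow> 'a \<Rightarrow> 'a) \<Rightarrow> 'r \<Rightarrow> ('a \<Rightarrow> 'a) \<Rightarrow>
    'a \<Rightarrow> 'a \<Rightarrow> 'a" where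
  "descendant_bracket scale br lam T x y = br (T x) y + br x (T y) + scale lam (br x y)"

definition descendant_action ::
  "('a::ab_group_add \<Rightarrow> 'a \<Rightarrow> 'a) \<Rightarrow> ('a \<Rightarrow> 'a) \<Rightarrow> 'a \<Rightarrow> 'a \<Rightarrow> 'a" where
  "descendant_action br T x y = br (T x) y - T (br x y)"

text \<open>
  \<open>Phi\<^sup>n\<close>; the set \<open>I\<close> of positions plays the role of \<open>i\<^sub>1 < \<dots> < i\<^sub>k\<close>. For \<open>n = 0\<close> the sum is
  empty and \<open>Phi\<^sup>0\<close> is the identity.
\<close>

definition rb_Phi ::
  "('r::comm_ring_1 \<Rightarrow> 'a::ab_group_add \<Rightarrow> 'a) \<Rightarrow> 'r \<Rightarrow> ('a \<Rightarrow> 'a) \<Rightarrow>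
    nat \<Rightarrow> ('a list \<Rightarrow> 'a) \<Rightarrow> 'a list \<Rightarrow> 'a" where
  "rb_Phi scale lam T n f xs =
     (if length xs = n then
        f (map T xs)
        - (\<Sum>k<n. scale (lam ^ (n - k - 1))
             (\<Sum>I | I \<subseteq> {..<n} \<and> card I = k.
                T (f (map (\<lambda>p. if p \<in> I then T (xs ! p) else xs ! p) [0..<n]))))
      else 0)"

text \<open>In degree \<open>0\<close>, where there is only one summand, the second component is \<open>0\<close>.\<close>

definition rb_cochains ::
  "('r::comm_ring_1 \<Rightarrow> 'a::ab_group_add \<Rightarrow> 'a) \<Rightarrow> nat \<Rightarrow>
    (('a list \<Rightarrow> 'a) \<times> ('a list \<Rightarrow> 'a)) set" where
  "rb_cochains scale n =
     alternating_maps scale n \<times> (if n = 0 then {0} else alternating_maps scale (n - 1))"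

definition rb_differential ::
  "('r::comm_ring_1 \<Rightarrow> 'a::ab_group_add \<Rightarrow> 'a) \<Rightarrow> ('a \<Rightarrow> 'a \<Rightarrow> 'a) \<Rightarrow> 'r \<Rightarrow> ('a \<Rightarrow> 'a) \<Rightarrow> nat \<Rightarrow>
    ('a list \<Rightarrow> 'a) \<times> ('a list \<Rightarrow> 'a) \<Rightarrow> ('a list \<Rightarrow> 'a) \<times> ('a list \<Rightarrow> 'a)" where
  "rb_differential scale br lam T n = (\<lambda>(f, g).
     (ce_differential scale br br n f,
      if n = 0 then - f
      else - ce_differential scale (descendant_action br T) (descendant_bracket scale br lam T)
               (n - 1) g
           - rb_Phi scale lam T n f))"

definition rb_cocycles ::
  "('r::comm_ring_1 \<Rightarrow> 'a::ab_group_add \<Rightarrow> 'a) \<Rightarrow> ('a \<Rightarrow> 'a \<Rightarrow> 'a) \<Rightarrow> 'r \<Rightarrow> ('a \<Rightarrow> 'a) \<Rightarrow> nat \<Rightarrow>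
    (('a list \<Rightarrow> 'a) \<times> ('a list \<Rightarrow> 'a)) set" where
  "rb_cocycles scale br lam T n =
     {c \<in> rb_cochains scale n. rb_differential scale br lam T n c = 0}"

definition rb_coboundaries ::
  "('r::comm_ring_1 \<Rightarrow> 'a::ab_group_add \<Rightarrow> 'a) \<Rightarrow> ('a \<Rightarrow> 'a \<Rightarrow> 'a) \<Rightarrow> 'r \<Rightarrow> ('a \<Rightarrow> 'a) \<Rightarrow> nat \<Rightarrow>
    (('a list \<Rightarrow> 'a) \<times> ('a list \<Rightarrow> 'a)) set" where
  "rb_coboundaries scale br lam T n =
     (if n = 0 then {0}
      else rb_differential scale br lam T (n - 1) ` rb_cochains scale (n - 1))"

text \<open>
  \<open>H\<^sup>n\<close> is the set of cosets of the coboundaries in the cocycles; its zero element is the coset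
  of \<open>0\<close>, namely the set of coboundaries.
\<close>

definition rb_cohomology ::
  "('r::comm_ring_1 \<Rightarrow> 'a::ab_group_add \<Rightarrow> 'a) \<Rightarrow> ('a \<Rightarrow> 'a \<Rightarrow> 'a) \<Rightarrow> 'r \<Rightarrow> ('a \<Rightarrow> 'a) \<Rightarrow> nat \<Rightarrow>
    (('a list \<Rightarrow> 'a) \<times> ('a list \<Rightarrow> 'a)) set set" where
  "rb_cohomology scale br lam T n =
     (\<lambda>z. (\<lambda>b. z + b) ` rb_coboundaries scale br lam T n) ` rb_cocycles scale br lam T n"

definition rb_cohomology_vanishes ::
  "('r::comm_ring_1 \<Rightarrow> 'a::ab_group_add \<Rightarrow> 'a) \<Rightarrow> ('a \<Rightarrow> 'a \<Rightarrow> 'a) \<Rightarrow> 'r \<Rightarrow> ('a \<Rightarrow> 'a) \<Rightarrow> nat \<Rightarrow>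
    bool" where
  "rb_cohomology_vanishes scale br lam T n \<longleftrightarrow>
     rb_cohomology scale br lam T n = {rb_coboundaries scale br lam T n}"

section \<open>Formal deformations\<close>

text \<open>
  \<open>g[[t]]\<close> is the type of formal power series with coefficients in \<open>g\<close>. The following three
  operations are the \<open>k[[t]]\<close>-module structure on it and the \<open>k[[t]]\<close>-(bi)linear extensions of
  a series of linear maps \<open>S\<^sub>i\<close> and of bilinear maps \<open>m\<^sub>i\<close>, i.e. they multiply out
  \<open>(\<Sum> c\<^sub>i t\<^sup>i) (\<Sum> u\<^sub>j t\<^sup>j)\<close>, \<open>(\<Sum> S\<^sub>i t\<^sup>i) (\<Sum> u\<^sub>j t\<^sup>j)\<close> and
  \<open>(\<Sum> m\<^sub>i t\<^sup>i) (\<Sum> u\<^sub>j t\<^sup>j, \<Sum> v\<^sub>k t\<^sup>k)\<close>.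
\<close>

definition fps_scale ::
  "('k::comm_ring_1 \<Rightarrow> 'a::ab_group_add \<Rightarrow> 'a) \<Rightarrow> 'k fps \<Rightarrow> 'a fps \<Rightarrow> 'a fps" where
  "fps_scale scale c u = Abs_fps (\<lambda>n. \<Sum>i\<le>n. scale (fps_nth c i) (fps_nth u (n - i)))"

definition fps_linear_map ::
  "(nat \<Rightarrow> 'a::ab_group_add \<Rightarrow> 'a) \<Rightarrow> 'a fps \<Rightarrow> 'a fps" where
  "fps_linear_map S u = Abs_fps (\<lambda>n. \<Sum>i\<le>n. S i (fps_nth u (n - i)))"

definition fps_bilinear_map ::
  "(nat \<Rightarrow> 'a::ab_group_add \<Rightarrow> 'a \<Rightarrow> 'a) \<Rightarrow> 'a fps \<Rightarrow> 'a fps \<Rightarrow> 'a fps" where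
  "fps_bilinear_map m u v =
     Abs_fps (\<lambda>n. \<Sum>i\<le>n. \<Sum>j\<le>n - i. m i (fps_nth u j) (fps_nth v (n - i - j)))"

definition formal_deformation ::
  "('k::field_char_0 \<Rightarrow> 'a::ab_group_add \<Rightarrow> 'a) \<Rightarrow> ('a \<Rightarrow> 'a \<Rightarrow> 'a) \<Rightarrow> 'k \<Rightarrow> ('a \<Rightarrow> 'a) \<Rightarrow>
    (nat \<Rightarrow> 'a \<Rightarrow> 'a \<Rightarrow> 'a) \<Rightarrow> (nat \<Rightarrow> 'a \<Rightarrow> 'a) \<Rightarrow> bool" where
  "formal_deformation scale br lam T m S \<longleftrightarrow>
     (\<forall>i. alternating_bilinear scale (m i)) \<and> m 0 = br \<and>
     (\<forall>i. module_hom scale scale (S i)) \<and> S 0 = T \<and>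
     rb_lie_algebra (fps_scale scale) (fps_bilinear_map m) (fps_const lam) (fps_linear_map S)"

text \<open>The morphism goes from the second deformation \<open>(m', S')\<close> to the first one \<open>(m, S)\<close>.\<close>

definition equivalent_deformations ::
  "('k::field_char_0 \<Rightarrow> 'a::ab_group_add \<Rightarrow> 'a) \<Rightarrow> 'k \<Rightarrow>
    (nat \<Rightarrow> 'a \<Rightarrow> 'a \<Rightarrow> 'a) \<Rightarrow> (nat \<Rightarrow> 'a \<Rightarrow> 'a) \<Rightarrow>
    (nat \<Rightarrow> 'a \<Rightarrow> 'a \<Rightarrow> 'a) \<Rightarrow> (nat \<Rightarrow> 'a \<Rightarrow> 'a) \<Rightarrow> bool" where
  "equivalent_deformations scale lam m S m' S' \<longleftrightarrow>
     (\<exists>phi. (\<forall>i. module_hom scale scale (phi i)) \<and> phi 0 = id \<and>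
        rb_lie_algebra_morphism (fps_scale scale) (fps_scale scale) (fps_const lam)
          (fps_bilinear_map m') (fps_linear_map S') (fps_bilinear_map m) (fps_linear_map S)
          (fps_linear_map phi))"

definition constant_series :: "'b::zero \<Rightarrow> nat \<Rightarrow> 'b" where
  "constant_series b i = (if i = 0 then b else 0)"

end

theory Submission
  imports Defs
begin

text \<open>
  An equivalence \<open>\<phi>\<^sub>t\<close> from the trivial deformation to \<open>(\<mu>\<^sub>t, T\<^sub>t)\<close> is built coefficient by coefficient.
  Suppose that \<open>\<phi> = \<Sum>\<^bsub>i<n\<^esub> \<phi>\<^sub>i t\<^sup>i\<close> respects bracket and operator modulo \<open>t\<^sup>n\<close>. Its failure to be
  a morphism is measured by the defects
  \<open>A(x, y) = \<mu>\<^sub>t(\<phi> x, \<phi> y) - \<phi>[x, y]\<close> and \<open>B(x) = T\<^sub>t(\<phi> x) - \<phi>(T x)\<close>, both divisible by \<open>t\<^sup>n\<close>.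
  The Jacobi identity and the Rota-Baxter identity on both sides force two identities on the
  defects of an arbitrary linear map (\<open>bracket_defect_jacobi\<close> and \<open>operator_defect_rota_baxter\<close>).
  Their coefficients of order \<open>n\<close> say exactly that the leading coefficients \<open>(A\<^sub>n, B\<^sub>n)\<close> form a
  \<open>2\<close>-cocycle of \<open>(g, T)\<close>. As the second cohomology vanishes, the cocycle is the coboundary of
  a linear map \<open>h\<close> (\<open>rb_2_cocycle_is_coboundary\<close>), and \<open>\<phi>\<^sub>n = - h\<close> removes the defect
  of order \<open>n\<close> (\<open>extend_equivalence\<close>). The map \<open>\<phi>\<close> never has to be inverted, and no deformation
  other than the given one and the trivial one appears.

  All equations between \<open>k[[t]]\<close>-multilinear maps on \<open>g[[t]]\<close> are checked on constant series only,
  which is enough by \<open>fps_linear_eqI\<close>. This gives the Rota-Baxter structure on the trivial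
  deformation and shows that a solution of all coefficient equations is a morphism.
\<close>

section \<open>Power series with coefficients in a module\<close>

lemma sum_atMost_reverse:
  fixes f :: "nat \<Rightarrow> 'a::comm_monoid_add"
  shows "(\<Sum>i\<le>n. f (n - i)) = (\<Sum>i\<le>n. f i)"
  by (rule sum.reindex_bij_witness[where i = "\<lambda>i. n - i" and j = "\<lambda>i. n - i"]) auto

lemma sum_triangle_by_diagonals:
  fixes g :: "nat \<Rightarrow> nat \<Rightarrow> 'a::comm_monoid_add"
  shows "(\<Sum>i\<le>n. \<Sum>j\<le>n - i. g i j) = (\<Sum>k\<le>n. \<Sum>i\<le>k. g i (k - i))"
proof -
  have "(SIGMA i:{..n}. {..n - i}) = {(i, j). i + j \<le> n}"
    by auto
  then show ?thesis
    using sum.triangle_reindex_eq[of g n] by (simp add: sum.Sigma)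
qed

lemma sum_triangle_swap:
  fixes g :: "nat \<Rightarrow> nat \<Rightarrow> 'a::comm_monoid_add"
  shows "(\<Sum>i\<le>n. \<Sum>j\<le>n - i. g i j) = (\<Sum>j\<le>n. \<Sum>i\<le>n - j. g i j)"
proof -
  have "(\<Sum>i\<le>k. g i (k - i)) = (\<Sum>j\<le>k. g (k - j) j)" for k
    using sum_atMost_reverse[of "\<lambda>j. g (k - j) j" k] by (simp cong: sum.cong_simp)
  then show ?thesis
    by (simp add: sum_triangle_by_diagonals[of g] sum_triangle_by_diagonals[of "\<lambda>j i. g i j"])
qed

context module
begin

lemma fps_scale_nth:
  "fps_nth (fps_scale scale c u) n = (\<Sum>i\<le>n. scale (fps_nth c i) (fps_nth u (n - i)))"
  by (simp add: fps_scale_def)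

lemma module_fps_scale: "module (fps_scale scale)"
proof
  fix c d :: "'a fps" and u v :: "'b fps"
  show "fps_scale scale c (u + v) = fps_scale scale c u + fps_scale scale c v"
    by (simp add: fps_eq_iff fps_scale_nth scale_right_distrib sum.distrib)
  show "fps_scale scale (c + d) u = fps_scale scale c u + fps_scale scale d u"
    by (simp add: fps_eq_iff fps_scale_nth scale_left_distrib sum.distrib)
  show "fps_scale scale c (fps_scale scale d u) = fps_scale scale (c * d) u"
  proof (rule fps_ext)
    fix n :: nat
    have "fps_nth (fps_scale scale c (fps_scale scale d u)) n =
        (\<Sum>i\<le>n. \<Sum>j\<le>n - i. scale (fps_nth c i * fps_nth d j) (fps_nth u (n - (i + j))))"
      by (simp add: fps_scale_nth scale_sum_right)
    also have "\<dots> = fps_nth (fps_scale scale (c * d) u) n"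
      by (simp add: fps_scale_nth sum_triangle_by_diagonals fps_mult_nth scale_sum_left
          atLeast0AtMost cong: sum.cong_simp)
    finally show "fps_nth (fps_scale scale c (fps_scale scale d u)) n =
        fps_nth (fps_scale scale (c * d) u) n" .
  qed
  have "fps_nth (fps_scale scale 1 u) n = (\<Sum>i\<le>n. if i = 0 then fps_nth u n else 0)" for n
    unfolding fps_scale_nth by (rule sum.cong) auto
  then show "fps_scale scale 1 u = u"
    by (simp add: fps_eq_iff)
qed

lemma fps_scale_const: "fps_nth (fps_scale scale (fps_const c) u) n = scale c (fps_nth u n)"
proof -
  have "fps_nth (fps_scale scale (fps_const c) u) n =
      (\<Sum>i\<le>n. if i = 0 then scale c (fps_nth u n) else 0)"
    unfolding fps_scale_nth by (rule sum.cong) auto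
  then show ?thesis by simp
qed

lemma fps_const_scale: "fps_const (scale c x) = fps_scale scale (fps_const c) (fps_const x)"
  by (simp add: fps_eq_iff fps_scale_const)

lemma fps_scale_X_nth:
  "fps_nth (fps_scale scale fps_X u) n = (if n = 0 then 0 else fps_nth u (n - 1))"
proof -
  have "fps_nth (fps_scale scale fps_X u) n =
      (\<Sum>i\<le>n. if i = 1 then fps_nth u (n - 1) else 0)"
    unfolding fps_scale_nth by (rule sum.cong) auto
  then show ?thesis by simp
qed

lemma fps_decompose_constant:
  "u = fps_const (fps_nth u 0) + fps_scale scale fps_X (fps_shift 1 u)"
  by (simp add: fps_eq_iff fps_scale_X_nth)

text \<open>
  For \<open>u = u\<^sub>0 + t u'\<close> the difference \<open>D\<close> of the two maps satisfies \<open>D u = t (D u')\<close>, so by induction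
  all coefficients of \<open>D u\<close> vanish: \<open>k[[t]]\<close>-linear maps are automatically \<open>t\<close>-adically continuous.
\<close>

lemma fps_linear_eqI:
  assumes F: "module_hom (fps_scale scale) (fps_scale scale) F"
    and G: "module_hom (fps_scale scale) (fps_scale scale) G"
    and const: "\<And>x. F (fps_const x) = G (fps_const x)"
  shows "F u = G u"
proof -
  have "fps_nth (F u) n = fps_nth (G u) n" for n
  proof (induction n arbitrary: u)
    case 0
    show ?case
      by (subst (1 2) fps_decompose_constant)
        (simp add: module_hom.add[OF F] module_hom.add[OF G] module_hom.scale[OF F]
          module_hom.scale[OF G] const fps_scale_X_nth)
  next
    case (Suc n)
    show ?case
      by (subst (1 2) fps_decompose_constant)
        (simp add: module_hom.add[OF F] module_hom.add[OF G] module_hom.scale[OF F]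
          module_hom.scale[OF G] const fps_scale_X_nth Suc)
  qed
  then show ?thesis by (simp add: fps_eq_iff)
qed

lemma module_hom_fps_linear_map:
  assumes S: "\<And>i. module_hom scale scale (S i)"
  shows "module_hom (fps_scale scale) (fps_scale scale) (fps_linear_map S)"
proof (intro module_hom.intro module_hom_axioms.intro module_fps_scale)
  fix c u v
  show "fps_linear_map S (u + v) = fps_linear_map S u + fps_linear_map S v"
    by (simp add: fps_eq_iff fps_linear_map_def module_hom.add[OF S] sum.distrib)
  show "fps_linear_map S (fps_scale scale c u) = fps_scale scale c (fps_linear_map S u)"
  proof (rule fps_ext)
    fix n :: nat
    have "fps_nth (fps_linear_map S (fps_scale scale c u)) n =
        (\<Sum>i\<le>n. \<Sum>j\<le>n - i. scale (fps_nth c j) (S i (fps_nth u (n - i - j))))"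
      by (simp add: fps_linear_map_def fps_scale_nth module_hom.sum[OF S] module_hom.scale[OF S])
    also have "\<dots> = (\<Sum>j\<le>n. \<Sum>i\<le>n - j. scale (fps_nth c j) (S i (fps_nth u (n - i - j))))"
      by (rule sum_triangle_swap)
    also have "\<dots> = fps_nth (fps_scale scale c (fps_linear_map S u)) n"
      by (simp add: fps_linear_map_def fps_scale_nth scale_sum_right add.commute)
    finally show "fps_nth (fps_linear_map S (fps_scale scale c u)) n =
        fps_nth (fps_scale scale c (fps_linear_map S u)) n" .
  qed
qed

end

lemma fps_linear_map_const:
  assumes "\<And>i. S i 0 = 0"
  shows "fps_linear_map S (fps_const x) = Abs_fps (\<lambda>i. S i x)"
proof (rule fps_ext)
  fix n :: nat
  have "fps_nth (fps_linear_map S (fps_const x)) n = (\<Sum>i\<le>n. if i = n then S n x else 0)"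
    unfolding fps_linear_map_def fps_nth_Abs_fps by (rule sum.cong) (auto simp: assms)
  then show "fps_nth (fps_linear_map S (fps_const x)) n = fps_nth (Abs_fps (\<lambda>i. S i x)) n"
    by simp
qed

text \<open>
  Only \<open>t\<^sup>0\<close> and \<open>t\<^sup>n\<close> can contribute to the coefficient of \<open>t\<^sup>n\<close> if an argument vanishes below
  order \<open>n\<close>: this makes the equations for the coefficient of order \<open>n\<close> of an equivalence linear.
\<close>

lemma fps_linear_map_leading:
  assumes "\<And>i. S i 0 = 0" and "\<And>k. k < n \<Longrightarrow> fps_nth u k = 0"
  shows "fps_nth (fps_linear_map S u) n = S 0 (fps_nth u n)"
proof -
  have "fps_nth (fps_linear_map S u) n = (\<Sum>i\<le>n. if i = 0 then S 0 (fps_nth u n) else 0)"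
    unfolding fps_linear_map_def fps_nth_Abs_fps by (rule sum.cong) (auto simp: assms)
  then show ?thesis by simp
qed

lemma fps_bilinear_map_leading_left:
  assumes "\<And>i y. m i 0 y = 0" and "\<And>k. k < n \<Longrightarrow> fps_nth u k = 0"
  shows "fps_nth (fps_bilinear_map m u v) n = m 0 (fps_nth u n) (fps_nth v 0)"
proof -
  have "m i (fps_nth u j) (fps_nth v (n - i - j)) =
      (if j = n then if i = 0 then m 0 (fps_nth u n) (fps_nth v 0) else 0 else 0)"
    if "i \<le> n" "j \<le> n - i" for i j
    using that assms by (cases "j < n") auto
  then have "fps_nth (fps_bilinear_map m u v) n =
      (\<Sum>i\<le>n. \<Sum>j\<le>n - i. if j = n then if i = 0 then m 0 (fps_nth u n) (fps_nth v 0) else 0 else 0)"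
    unfolding fps_bilinear_map_def fps_nth_Abs_fps by (intro sum.cong) auto
  also have "\<dots> = (\<Sum>i\<le>n. if i = 0 then m 0 (fps_nth u n) (fps_nth v 0) else 0)"
    by (intro sum.cong) auto
  finally show ?thesis by simp
qed

lemma fps_bilinear_map_leading_right:
  assumes "\<And>i x. m i x 0 = 0" and "\<And>k. k < n \<Longrightarrow> fps_nth v k = 0"
  shows "fps_nth (fps_bilinear_map m u v) n = m 0 (fps_nth u 0) (fps_nth v n)"
proof -
  have "m i (fps_nth u j) (fps_nth v (n - i - j)) =
      (if j = 0 then if i = 0 then m 0 (fps_nth u 0) (fps_nth v n) else 0 else 0)"
    if "i \<le> n" "j \<le> n - i" for i j
    using that assms by (cases "n - i - j < n") auto
  then have "fps_nth (fps_bilinear_map m u v) n =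
      (\<Sum>i\<le>n. \<Sum>j\<le>n - i. if j = 0 then if i = 0 then m 0 (fps_nth u 0) (fps_nth v n) else 0 else 0)"
    unfolding fps_bilinear_map_def fps_nth_Abs_fps by (intro sum.cong) auto
  also have "\<dots> = (\<Sum>i\<le>n. if i = 0 then m 0 (fps_nth u 0) (fps_nth v n) else 0)"
    by (intro sum.cong) auto
  finally show ?thesis by simp
qed

section \<open>Brackets and the trivial deformation\<close>

context lie_algebra
begin

lemma br_hom_right: "module_hom scale scale (br x)"
  and br_hom_left: "module_hom scale scale (\<lambda>x. br x y)"
  and br_self: "br x x = 0"
  using alternating_bilinear by (simp_all add: alternating_bilinear_def)

lemmas br_add_right = module_hom.add[OF br_hom_right]
  and br_add_left = module_hom.add[OF br_hom_left]
  and br_neg_right = module_hom.neg[OF br_hom_right]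
  and br_neg_left = module_hom.neg[OF br_hom_left]
  and br_zero_right = module_hom.zero[OF br_hom_right]
  and br_zero_left = module_hom.zero[OF br_hom_left]
  and br_scale_right = module_hom.scale[OF br_hom_right]
  and br_scale_left = module_hom.scale[OF br_hom_left]

lemma br_antisym: "br y x = - br x y"
  using br_self[of "x + y"] br_self[of x] br_self[of y]
  by (simp add: br_add_left br_add_right eq_neg_iff_add_eq_0 add.commute)

end

lemma fps_bilinear_map_constant_series:
  "fps_bilinear_map (constant_series b) u v =
     Abs_fps (\<lambda>n. \<Sum>j\<le>n. b (fps_nth u j) (fps_nth v (n - j)))"
proof (rule fps_ext)
  fix n :: nat
  have "(\<Sum>j\<le>n - i. constant_series b i (fps_nth u j) (fps_nth v (n - i - j))) =
      (if i = 0 then \<Sum>j\<le>n. b (fps_nth u j) (fps_nth v (n - j)) else 0)" for i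
    by (simp add: constant_series_def)
  then show "fps_nth (fps_bilinear_map (constant_series b) u v) n =
      fps_nth (Abs_fps (\<lambda>n. \<Sum>j\<le>n. b (fps_nth u j) (fps_nth v (n - j)))) n"
    by (simp add: fps_bilinear_map_def)
qed

context rb_lie_algebra
begin

lemmas T_add = module_hom.add[OF linear_T]
  and T_neg = module_hom.neg[OF linear_T]
  and T_scale = module_hom.scale[OF linear_T]
  and T_zero = module_hom.zero[OF linear_T]

abbreviation (input) fbr where
  "fbr \<equiv> fps_bilinear_map (constant_series br)"

abbreviation (input) fT where
  "fT \<equiv> fps_linear_map (constant_series T)"

lemma fbr_const: "fbr (fps_const x) (fps_const y) = fps_const (br x y)"
proof (rule fps_ext)
  fix n :: nat
  have "br (if j = 0 then x else 0) (if n - j = 0 then y else 0) =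
      (if j = 0 then if n = 0 then br x y else 0 else 0)" if "j \<le> n" for j
    using that by (cases "n = 0") (auto simp: br_zero_left br_zero_right)
  then show "fps_nth (fbr (fps_const x) (fps_const y)) n = fps_nth (fps_const (br x y)) n"
    by (simp add: fps_bilinear_map_constant_series)
qed

lemma fT_const: "fT (fps_const x) = fps_const (T x)"
  by (simp add: fps_linear_map_const constant_series_def T_zero fps_eq_iff)

text \<open>
  With one argument fixed, the constant bracket is the map of a series of linear maps, namely of
  \<open>x \<mapsto> [x, v\<^sub>i]\<close> or \<open>y \<mapsto> [u\<^sub>i, y]\<close>.
\<close>

lemma fbr_hom_left: "module_hom (fps_scale scale) (fps_scale scale) (\<lambda>u. fbr u v)"
proof -
  have "fbr u v = fps_linear_map (\<lambda>i x. br x (fps_nth v i)) u" for u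
  proof (rule fps_ext)
    fix n :: nat
    show "fps_nth (fbr u v) n = fps_nth (fps_linear_map (\<lambda>i x. br x (fps_nth v i)) u) n"
      using sum_atMost_reverse[of "\<lambda>i. br (fps_nth u (n - i)) (fps_nth v i)" n]
      by (simp add: fps_bilinear_map_constant_series fps_linear_map_def cong: sum.cong_simp)
  qed
  then show ?thesis
    using module_hom_fps_linear_map[of "\<lambda>i x. br x (fps_nth v i)"] br_hom_left by simp
qed

lemma fbr_hom_right: "module_hom (fps_scale scale) (fps_scale scale) (fbr u)"
proof -
  have "fbr u = fps_linear_map (\<lambda>i. br (fps_nth u i))"
    by (auto simp: fps_bilinear_map_constant_series fps_linear_map_def)
  then show ?thesis
    using module_hom_fps_linear_map[of "\<lambda>i. br (fps_nth u i)"] br_hom_right by simp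
qed

lemma fT_hom: "module_hom (fps_scale scale) (fps_scale scale) fT"
proof -
  interpret P: module_pair scale scale ..
  show ?thesis
    using linear_T P.module_hom_zero
    by (intro module_hom_fps_linear_map) (auto simp: constant_series_def zero_fun_def)
qed

lemmas fbr_linear = module_hom.add[OF fbr_hom_left] module_hom.add[OF fbr_hom_right]
  module_hom.scale[OF fbr_hom_left] module_hom.scale[OF fbr_hom_right]

lemma fbr_antisym: "fbr v u = - fbr u v"
proof -
  interpret F: module_pair "fps_scale scale" "fps_scale scale"
    by (intro module_pair.intro module_fps_scale)
  have "fbr v (fps_const x) = - fbr (fps_const x) v" for x
    by (rule fps_linear_eqI[OF fbr_hom_left F.module_hom_neg[OF fbr_hom_right]])
      (simp add: fbr_const br_antisym[of _ x])
  then show ?thesis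
    by (rule fps_linear_eqI[OF fbr_hom_right F.module_hom_neg[OF fbr_hom_left]])
qed

text \<open>
  Over a ring with \<open>2\<close>-torsion antisymmetry would not suffice, so \<open>u = u\<^sub>0 + t u'\<close> is inserted: the
  mixed terms cancel and what remains is \<open>t\<^sup>2 [u', u']\<close>.
\<close>

lemma fbr_self: "fbr u u = 0"
proof -
  have "fps_nth (fbr u u) n = 0" for n
  proof (induction n arbitrary: u rule: less_induct)
    case (less n)
    define x where "x = fps_const (fps_nth u 0)"
    define w where "w = fps_scale scale fps_X (fps_shift 1 u)"
    have u: "u = x + w"
      unfolding x_def w_def by (rule fps_decompose_constant)
    have "fbr u u = fbr x x + (fbr x w + fbr w x) + fbr w w"
      unfolding u by (simp add: fbr_linear)
    also have "\<dots> = fbr w w"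
      by (simp add: fbr_antisym[of w x]) (simp add: x_def fbr_const br_self)
    finally show ?case
      using less by (simp add: w_def fbr_linear fps_scale_X_nth)
  qed
  then show ?thesis by (simp add: fps_eq_iff)
qed

lemma fbr_jacobi: "fbr u (fbr v w) + fbr v (fbr w u) + fbr w (fbr u v) = 0"
proof -
  interpret F: module_pair "fps_scale scale" "fps_scale scale"
    by (intro module_pair.intro module_fps_scale)
  note homs = F.module_hom_add fbr_hom_left fbr_hom_right F.module_hom_zero
    module_hom_compose[OF fbr_hom_left fbr_hom_right, unfolded comp_def]
    module_hom_compose[OF fbr_hom_right fbr_hom_right, unfolded comp_def]
    module_hom_compose[OF fbr_hom_left fbr_hom_left, unfolded comp_def]
    module_hom_compose[OF fbr_hom_right fbr_hom_left, unfolded comp_def]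
  let ?J = "\<lambda>u v w. fbr u (fbr v w) + fbr v (fbr w u) + fbr w (fbr u v)"
  have 1: "?J (fps_const x) (fps_const y) (fps_const z) = 0" for x y z
    by (simp add: fbr_const jacobi)
  have 2: "?J (fps_const x) (fps_const y) w = 0" for x y w
    by (rule fps_linear_eqI[where G = "\<lambda>_. 0" and F = "\<lambda>w. ?J (fps_const x) (fps_const y) w"])
      (intro homs 1)+
  have 3: "?J (fps_const x) v w = 0" for x v w
    by (rule fps_linear_eqI[where G = "\<lambda>_. 0" and F = "\<lambda>v. ?J (fps_const x) v w"])
      (intro homs 2)+
  show "?J u v w = 0"
    by (rule fps_linear_eqI[where G = "\<lambda>_. 0" and F = "\<lambda>u. ?J u v w"])
      (intro homs 3)+
qed

lemma rb_lie_algebra_trivial_deformation: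
  "rb_lie_algebra (fps_scale scale) fbr (fps_const lam) fT"
proof -
  interpret F: module_pair "fps_scale scale" "fps_scale scale"
    by (intro module_pair.intro module_fps_scale)
  note homs = F.module_hom_add F.module_hom_scale fbr_hom_left fbr_hom_right fT_hom
    module_hom_compose[OF fT_hom fbr_hom_right, unfolded comp_def]
    module_hom_compose[OF fT_hom fbr_hom_left, unfolded comp_def]
    module_hom_compose[OF _ fT_hom, unfolded comp_def]
  let ?L = "\<lambda>u v. fbr (fT u) (fT v)"
  let ?R = "\<lambda>u v. fT (fbr (fT u) v + fbr u (fT v) + fps_scale scale (fps_const lam) (fbr u v))"
  have 1: "?L (fps_const x) (fps_const y) = ?R (fps_const x) (fps_const y)" for x y
    by (simp add: fbr_const fT_const rota_baxter flip: fps_const_scale)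
  have 2: "?L (fps_const x) v = ?R (fps_const x) v" for x v
    by (rule fps_linear_eqI[where F = "?L (fps_const x)" and G = "?R (fps_const x)"])
      (intro homs 1)+
  have 3: "?L u v = ?R u v" for u v
    by (rule fps_linear_eqI[where F = "\<lambda>u. ?L u v" and G = "\<lambda>u. ?R u v"])
      (intro homs 2)+
  show ?thesis
    by (intro rb_lie_algebra.intro lie_algebra.intro lie_algebra_axioms.intro
        rb_lie_algebra_axioms.intro module_fps_scale fT_hom fbr_jacobi 3)
      (simp add: alternating_bilinear_def fbr_hom_left fbr_hom_right fbr_self)
qed

end

section \<open>Two-cocycles\<close>

definition bilinear_cochain :: "('a \<Rightarrow> 'a \<Rightarrow> 'a::zero) \<Rightarrow> 'a list \<Rightarrow> 'a" where
  "bilinear_cochain b xs = (if length xs = 2 then b (xs ! 0) (xs ! 1) else 0)"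

definition linear_cochain :: "('a \<Rightarrow> 'a::zero) \<Rightarrow> 'a list \<Rightarrow> 'a" where
  "linear_cochain h xs = (if length xs = 1 then h (xs ! 0) else 0)"

lemma length_2_conv: "length xs = 2 \<longleftrightarrow> (\<exists>x y. xs = [x, y])"
  by (auto simp: numeral_2_eq_2 length_Suc_conv)

lemma length_3_conv: "length xs = 3 \<longleftrightarrow> (\<exists>x y z. xs = [x, y, z])"
  by (auto simp: numeral_3_eq_3 length_Suc_conv)

context rb_lie_algebra
begin

lemma bilinear_cochain_alternating:
  assumes "alternating_bilinear scale b"
  shows "bilinear_cochain b \<in> alternating_maps scale 2"
proof -
  have hom: "module_hom scale scale (\<lambda>x. bilinear_cochain b (xs[i := x]))"
    if "length xs = 2" "i < 2" for xs i
  proof -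
    from that consider "i = 0" | "i = 1" by linarith
    then show ?thesis
      using assms that by cases (auto simp: bilinear_cochain_def alternating_bilinear_def)
  qed
  have "bilinear_cochain b xs = 0" if "i < j" "j < 2" "xs ! i = xs ! j" for xs i j
  proof -
    from that(1,2) have "i = 0" and "j = 1" by auto
    with that(3) have "xs ! 0 = xs ! 1" by simp
    then show ?thesis
      using assms by (auto simp: bilinear_cochain_def alternating_bilinear_def)
  qed
  moreover have "bilinear_cochain b xs = 0" if "length xs \<noteq> 2" for xs
    using that by (simp add: bilinear_cochain_def)
  ultimately show ?thesis
    using hom unfolding alternating_maps_def by blast
qed

lemma linear_cochain_alternating:
  assumes "module_hom scale scale h"
  shows "linear_cochain h \<in> alternating_maps scale 1"
  using assms by (auto simp: alternating_maps_def linear_cochain_def)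

lemma zero_alternating: "0 \<in> alternating_maps scale n"
proof -
  interpret P: module_pair scale scale ..
  show ?thesis
    using P.module_hom_zero by (auto simp: alternating_maps_def)
qed

lemma ce_differential_0:
  "ce_differential scale rho b 0 f [x] = - rho x (f [])"
  by (simp add: ce_differential_def nths_Cons)

lemma ce_differential_1:
  "ce_differential scale rho b 1 f [x, y] = rho x (f [y]) - rho y (f [x]) - f [b x y]"
  by (simp add: ce_differential_def nths_Cons numeral_2_eq_2)

lemma ce_differential_2:
  "ce_differential scale rho b 2 f [x, y, z] =
     - rho x (f [y, z]) + rho y (f [x, z]) - rho z (f [x, y])
     + f [b x y, z] - f [b x z, y] + f [b y z, x]"
  by (simp add: ce_differential_def nths_Cons numeral_3_eq_3 numeral_2_eq_2)

lemma rb_Phi_1: "rb_Phi scale lam T 1 f [x] = f [T x] - T (f [x])"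
proof -
  have "{I. I \<subseteq> {..<Suc 0} \<and> card I = 0} = {{}::nat set}"
    using finite_subset by fastforce
  then show ?thesis by (simp add: rb_Phi_def)
qed

lemma rb_Phi_2:
  "rb_Phi scale lam T 2 f [x, y] =
     f [T x, T y] - scale lam (T (f [x, y])) - T (f [T x, y]) - T (f [x, T y])"
proof -
  have 0: "{I. I \<subseteq> {..<2} \<and> card I = 0} = {{}::nat set}"
    using finite_subset by fastforce
  have 1: "{I. I \<subseteq> {..<2} \<and> card I = Suc 0} = {{0::nat}, {1}}"
    by (auto simp: card_Suc_eq less_2_cases_iff)
  show ?thesis
    using 0 1 by (simp add: rb_Phi_def numeral_2_eq_2)
qed


text \<open>
  A \<open>1\<close>-cochain is a pair \<open>(f, v)\<close> of a linear map and an element of \<open>g\<close>. Since \<open>(ad v, - v)\<close> is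
  the coboundary of \<open>v\<close> and hence a cocycle, \<open>(f, v)\<close> and \<open>(f + ad v, 0)\<close> have the same coboundary;
  so every coboundary comes from a single linear map \<open>h\<close>. The hypotheses \<open>jac\<close> and \<open>rb\<close> are the
  equations \<open>\<delta>\<^sub>C\<^sub>E E = 0\<close> and \<open>\<partial>\<^sub>C\<^sub>E F + \<Phi>\<^sup>2 E = 0\<close> with all signs resolved.
\<close>

lemma rb_2_cocycle_is_coboundary:
  assumes van: "rb_cohomology_vanishes scale br lam T 2"
    and E: "alternating_bilinear scale E" and F: "module_hom scale scale F"
    and jac: "\<And>x y z. E x (br y z) + E y (br z x) + E z (br x y)
                + (br x (E y z) + br y (E z x) + br z (E x y)) = 0"
    and rb: "\<And>x y. E (T x) (T y) + br (F x) (T y) + br (T x) (F y) =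
               F (descendant_bracket scale br lam T x y)
               + T (E (T x) y + E x (T y) + scale lam (E x y) + br (F x) y + br x (F y))"
  obtains h where "module_hom scale scale h"
    and "\<And>x y. E x y = br x (h y) + br (h x) y - h (br x y)"
    and "\<And>x. F x = T (h x) - h (T x)"
proof -
  let ?B = "rb_coboundaries scale br lam T 2"
  let ?z = "(bilinear_cochain E, linear_cochain F)"
  note E_hom_right = E[unfolded alternating_bilinear_def, THEN conjunct1, rule_format]
    and E_hom_left = E[unfolded alternating_bilinear_def, THEN conjunct2, THEN conjunct1, rule_format]
    and E_self = E[unfolded alternating_bilinear_def, THEN conjunct2, THEN conjunct2, rule_format]
  have E_antisym: "E y x = - E x y" for x y
    using E_self[of "x + y"] E_self[of x] E_self[of y]
    by (simp add: module_hom.add[OF E_hom_left] module_hom.add[OF E_hom_right]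
        eq_neg_iff_add_eq_0 add.commute)
  have "ce_differential scale br br 2 (bilinear_cochain E) xs = 0" for xs
  proof (cases "length xs = 3")
    case True
    then obtain x y z where xs: "xs = [x, y, z]"
      using length_3_conv[THEN iffD1, OF True] by blast
    have "ce_differential scale br br 2 (bilinear_cochain E) xs =
          - (E x (br y z) + E y (br z x) + E z (br x y)
             + (br x (E y z) + br y (E z x) + br z (E x y)))"
        unfolding xs ce_differential_2
        by (simp add: bilinear_cochain_def E_antisym[of "br x y" z] E_antisym[of "br y z" x]
            br_antisym[of z x] E_antisym[of "br x z" y] E_antisym[of z x] br_neg_right
            module_hom.neg[OF E_hom_right])
    then show ?thesis
      by (simp only: jac minus_zero)
  qed (simp add: ce_differential_def)
  moreover have "- ce_differential scale (descendant_action br T)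
      (descendant_bracket scale br lam T) 1 (linear_cochain F) xs
      - rb_Phi scale lam T 2 (bilinear_cochain E) xs = 0" for xs
  proof (cases "length xs = 2")
    case True
    then obtain x y where xs: "xs = [x, y]"
      using length_2_conv[THEN iffD1, OF True] by blast
    show ?thesis
      unfolding xs ce_differential_1 rb_Phi_2 using rb[of x y]
      by (simp add: bilinear_cochain_def linear_cochain_def descendant_action_def
          br_antisym[of "T y" "F x"] br_antisym[of y "F x"] T_add T_neg T_scale algebra_simps)
  qed (simp add: ce_differential_def rb_Phi_def)
  ultimately have "rb_differential scale br lam T 2 ?z = 0"
    by (auto simp: rb_differential_def fun_eq_iff zero_prod_def)
  then have "?z \<in> rb_cocycles scale br lam T 2"
    using bilinear_cochain_alternating[OF E] linear_cochain_alternating[OF F]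
    by (simp add: rb_cocycles_def rb_cochains_def)
  then have coset: "(\<lambda>b. ?z + b) ` ?B = ?B"
    using van unfolding rb_cohomology_vanishes_def rb_cohomology_def by blast
  \<comment> \<open>The coset of the cocycle equals \<open>?B\<close>; it contains the cocycle itself because \<open>0\<close> is in \<open>?B\<close>.\<close>
  have "0 \<in> ?B"
  proof -
    have "rb_differential scale br lam T 1 0 = 0"
      by (auto simp: rb_differential_def zero_prod_def fun_eq_iff ce_differential_def rb_Phi_def
          br_zero_right descendant_action_def T_zero)
    moreover have "0 \<in> rb_cochains scale 1"
      by (auto simp: rb_cochains_def zero_prod_def zero_alternating)
    ultimately show ?thesis
      by (force simp: rb_coboundaries_def)
  qed
  with coset have "?z \<in> ?B"
    by (metis add.right_neutral image_eqI)
  then obtain f v where f: "f \<in> alternating_maps scale 1"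
    and d: "rb_differential scale br lam T 1 (f, v) = ?z"
    by (auto simp: rb_coboundaries_def rb_cochains_def)
  define h where "h x = f [x] + br (v []) x" for x
  have f_hom: "module_hom scale scale (\<lambda>x. f [x])"
  proof -
    have "module_hom scale scale (\<lambda>x. f (xs[i := x]))" if "length xs = 1 \<and> i < 1" for xs i
      using f that by (simp add: alternating_maps_def)
    from this[of "[undefined]" 0] show ?thesis by simp
  qed
  interpret P: module_pair scale scale ..
  have h: "module_hom scale scale h"
    unfolding h_def by (intro P.module_hom_add f_hom br_hom_right)
  moreover have "E x y = br x (h y) + br (h x) y - h (br x y)" for x y
  proof -
    have "E x y = ce_differential scale br br 1 f [x, y]"
      using arg_cong[OF d, of "\<lambda>c. fst c [x, y]"]
      by (simp add: rb_differential_def bilinear_cochain_def)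
    then show ?thesis
      unfolding ce_differential_1 h_def
      using jacobi[of x "v []" y]
      by (simp add: br_add_left br_add_right br_antisym[of y "f [x]"] br_antisym[of x "v []"]
          br_antisym[of "br (v []) x" y] br_antisym[of y x] br_neg_right add_eq_0_iff algebra_simps)
  qed
  moreover have "F x = T (h x) - h (T x)" for x
  proof -
    have "F x = - ce_differential scale (descendant_action br T)
        (descendant_bracket scale br lam T) 0 v [x] - rb_Phi scale lam T 1 f [x]"
      using arg_cong[OF d, of "\<lambda>c. snd c [x]"]
      by (simp add: rb_differential_def linear_cochain_def)
    then show ?thesis
      unfolding ce_differential_0 rb_Phi_1 h_def descendant_action_def
      by (simp add: br_antisym[of _ "v []"] T_add T_neg algebra_simps)
  qed
  ultimately show ?thesis
    by (rule that)
qed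

end

section \<open>The defect of a linear map between Rota-Baxter Lie algebras\<close>

text \<open>
  A linear map that is not assumed to respect the brackets and operators; its deviation from a
  morphism satisfies identities inherited from the axioms on both sides.
\<close>

locale rb_linear_map =
  source: rb_lie_algebra scale br lam T + target: rb_lie_algebra scale' br' lam T'
  for scale :: "'r::comm_ring_1 \<Rightarrow> 'a::ab_group_add \<Rightarrow> 'a"
    and scale' :: "'r \<Rightarrow> 'b::ab_group_add \<Rightarrow> 'b"
    and lam :: 'r
    and br :: "'a \<Rightarrow> 'a \<Rightarrow> 'a" and T :: "'a \<Rightarrow> 'a"
    and br' :: "'b \<Rightarrow> 'b \<Rightarrow> 'b" and T' :: "'b \<Rightarrow> 'b" +
  fixes phi :: "'a \<Rightarrow> 'b"
  assumes linear_phi: "module_hom scale scale' phi"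
begin

definition bracket_defect :: "'a \<Rightarrow> 'a \<Rightarrow> 'b" where
  "bracket_defect x y = br' (phi x) (phi y) - phi (br x y)"

definition operator_defect :: "'a \<Rightarrow> 'b" where
  "operator_defect x = T' (phi x) - phi (T x)"

lemma br'_phi_phi: "br' (phi x) (phi y) = phi (br x y) + bracket_defect x y"
  by (simp add: bracket_defect_def)

lemma T'_phi: "T' (phi x) = phi (T x) + operator_defect x"
  by (simp add: operator_defect_def)

text \<open>
  This is the Jacobi identity for \<open>phi x\<close>, \<open>phi y\<close>, \<open>phi z\<close> with every bracket of two values of
  \<open>phi\<close> replaced by a value of \<open>phi\<close> plus a defect; the values of \<open>phi\<close> cancel by the Jacobi
  identity of the source.
\<close>

lemma bracket_defect_jacobi:
  "bracket_defect x (br y z) + bracket_defect y (br z x) + bracket_defect z (br x y)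
   + (br' (phi x) (bracket_defect y z) + br' (phi y) (bracket_defect z x)
      + br' (phi z) (bracket_defect x y)) = 0"
  (is "?lhs = 0")
proof -
  have *: "br' (phi x) (br' (phi y) (phi z)) =
      phi (br x (br y z)) + bracket_defect x (br y z) + br' (phi x) (bracket_defect y z)" for x y z
    by (simp add: br'_phi_phi target.br_add_right)
  have "phi (br x (br y z) + br y (br z x) + br z (br x y)) + ?lhs = 0"
    using target.jacobi[of "phi x" "phi y" "phi z"] unfolding *
    by (simp add: module_hom.add[OF linear_phi] add_ac)
  then show ?thesis
    by (simp add: source.jacobi module_hom.zero[OF linear_phi])
qed

text \<open>
  The same substitution in the Rota-Baxter identity for \<open>phi x\<close> and \<open>phi y\<close>. It has one term
  quadratic in the defects, \<open>br' (operator_defect x) (operator_defect y)\<close>.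
\<close>

lemma operator_defect_rota_baxter:
  "bracket_defect (T x) (T y) + br' (operator_defect x) (phi (T y))
     + br' (phi (T x)) (operator_defect y) + br' (operator_defect x) (operator_defect y) =
   operator_defect (descendant_bracket scale br lam T x y)
     + T' (bracket_defect (T x) y + bracket_defect x (T y) + scale' lam (bracket_defect x y)
           + br' (operator_defect x) (phi y) + br' (phi x) (operator_defect y))"
proof -
  let ?d = "descendant_bracket scale br lam T x y"
  have "br' (T' (phi x)) (T' (phi y)) = phi (br (T x) (T y)) + bracket_defect (T x) (T y)
      + br' (operator_defect x) (phi (T y)) + br' (phi (T x)) (operator_defect y)
      + br' (operator_defect x) (operator_defect y)"
    by (simp add: T'_phi target.br_add_left target.br_add_right br'_phi_phi add_ac)
  moreover have "br' (T' (phi x)) (phi y) + br' (phi x) (T' (phi y))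
        + scale' lam (br' (phi x) (phi y)) =
      phi ?d + (bracket_defect (T x) y + bracket_defect x (T y) + scale' lam (bracket_defect x y)
           + br' (operator_defect x) (phi y) + br' (phi x) (operator_defect y))"
    by (simp add: descendant_bracket_def T'_phi target.br_add_left target.br_add_right br'_phi_phi
        target.scale_right_distrib module_hom.add[OF linear_phi] module_hom.scale[OF linear_phi]
        add_ac)
  moreover have "phi (br (T x) (T y)) = phi (T ?d)"
    by (simp add: source.rota_baxter descendant_bracket_def)
  ultimately show ?thesis
    using target.rota_baxter[of "phi x" "phi y"]
    by (simp add: target.T_add T'_phi add_ac)
qed

end

section \<open>Building the equivalence order by order\<close>

text \<open>
  The series \<open>Abs_fps (\<lambda>i. f i x)\<close> is \<open>\<phi>\<^sub>t x\<close> for a constant \<open>x\<close>, so these are the coefficients of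
  \<open>t\<^sup>n\<close> in the morphism equations on constants. They involve \<open>f i\<close> for \<open>i \<le> n\<close> only.
\<close>

definition equivalence_at_order ::
  "('a \<Rightarrow> 'a \<Rightarrow> 'a) \<Rightarrow> ('a \<Rightarrow> 'a) \<Rightarrow> (nat \<Rightarrow> 'a::ab_group_add \<Rightarrow> 'a \<Rightarrow> 'a) \<Rightarrow> (nat \<Rightarrow> 'a \<Rightarrow> 'a) \<Rightarrow>
    (nat \<Rightarrow> 'a \<Rightarrow> 'a) \<Rightarrow> nat \<Rightarrow> bool" where
  "equivalence_at_order br T m S f n \<longleftrightarrow>
     (\<forall>x y. fps_nth (fps_bilinear_map m (Abs_fps (\<lambda>i. f i x)) (Abs_fps (\<lambda>i. f i y))) n = f n (br x y)) \<and>
     (\<forall>x. fps_nth (fps_linear_map S (Abs_fps (\<lambda>i. f i x))) n = f n (T x))"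

lemma equivalence_at_order_cong:
  assumes "\<And>i. i \<le> n \<Longrightarrow> f i = g i"
  shows "equivalence_at_order br T m S f n \<longleftrightarrow> equivalence_at_order br T m S g n"
  using assms
  by (simp add: equivalence_at_order_def fps_bilinear_map_def fps_linear_map_def cong: sum.cong_simp)

locale rb_deformation = rb_lie_algebra scale br lam T
  for scale :: "'k::field_char_0 \<Rightarrow> 'a::ab_group_add \<Rightarrow> 'a" and br lam T +
  fixes m :: "nat \<Rightarrow> 'a \<Rightarrow> 'a \<Rightarrow> 'a" and S :: "nat \<Rightarrow> 'a \<Rightarrow> 'a"
  assumes deformation: "formal_deformation scale br lam T m S"
begin

lemma m_0: "m 0 = br" and S_0: "S 0 = T"
  and m_alternating: "alternating_bilinear scale (m i)"
  and S_hom: "module_hom scale scale (S i)"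
  and target: "rb_lie_algebra (fps_scale scale) (fps_bilinear_map m) (fps_const lam)
    (fps_linear_map S)"
  using deformation by (simp_all add: formal_deformation_def)

lemma m_zero: "m i 0 y = 0" "m i x 0 = 0"
proof -
  have "module_hom scale scale (\<lambda>x. m i x y)" "module_hom scale scale (m i x)"
    using m_alternating[of i] by (simp_all add: alternating_bilinear_def)
  then show "m i 0 y = 0" "m i x 0 = 0"
    by (auto dest: module_hom.zero)
qed

lemma S_zero: "S i 0 = 0"
  by (rule module_hom.zero[OF S_hom])

lemma equivalence_at_order_0:
  assumes "f 0 = id"
  shows "equivalence_at_order br T m S f 0"
  using assms by (simp add: equivalence_at_order_def fps_bilinear_map_def fps_linear_map_def m_0 S_0)

lemma rb_linear_map_series:
  assumes "\<And>i. module_hom scale scale (f i)"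
  shows "rb_linear_map (fps_scale scale) (fps_scale scale) (fps_const lam)
    (fps_bilinear_map (constant_series br)) (fps_linear_map (constant_series T))
    (fps_bilinear_map m) (fps_linear_map S) (fps_linear_map f)"
  by (intro rb_linear_map.intro rb_linear_map_axioms.intro rb_lie_algebra_trivial_deformation
      target module_hom_fps_linear_map assms)

lemma equivalent_to_trivial:
  assumes f: "\<And>i. module_hom scale scale (f i)" and f_0: "f 0 = id"
    and eqs: "\<And>n. equivalence_at_order br T m S f n"
  shows "equivalent_deformations scale lam m S (constant_series br) (constant_series T)"
proof -
  interpret D: rb_linear_map "fps_scale scale" "fps_scale scale" "fps_const lam"
    "fps_bilinear_map (constant_series br)" "fps_linear_map (constant_series T)"
    "fps_bilinear_map m" "fps_linear_map S" "fps_linear_map f"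
    by (rule rb_linear_map_series[OF f])
  note hom = D.linear_phi
  note f_const = fps_linear_map_const[of f, OF module_hom.zero[OF f]]
  have op: "fps_linear_map f (fT u) = fps_linear_map S (fps_linear_map f u)" for u
  proof -
    have "fps_linear_map f (fT (fps_const x)) = fps_linear_map S (fps_linear_map f (fps_const x))" for x
      using eqs by (simp add: fT_const f_const fps_eq_iff equivalence_at_order_def)
    then show ?thesis
      by (rule fps_linear_eqI[OF module_hom_compose[OF fT_hom hom, unfolded comp_def]
            module_hom_compose[OF hom D.target.linear_T, unfolded comp_def]])
  qed
  let ?L = "\<lambda>u v. fps_linear_map f (fbr u v)"
  let ?R = "\<lambda>u v. fps_bilinear_map m (fps_linear_map f u) (fps_linear_map f v)"
  have 1: "?L (fps_const x) (fps_const y) = ?R (fps_const x) (fps_const y)" for x y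
    using eqs by (simp add: fbr_const f_const fps_eq_iff equivalence_at_order_def)
  have 2: "?L (fps_const x) v = ?R (fps_const x) v" for x v
    using 1 by (rule fps_linear_eqI[OF module_hom_compose[OF fbr_hom_right hom, unfolded comp_def]
            module_hom_compose[OF hom D.target.br_hom_right, unfolded comp_def]])
  have br: "?L u v = ?R u v" for u v
    using 2 by (rule fps_linear_eqI[OF module_hom_compose[OF fbr_hom_left hom, unfolded comp_def]
            module_hom_compose[OF hom D.target.br_hom_left, unfolded comp_def]])
  have "rb_lie_algebra_morphism (fps_scale scale) (fps_scale scale) (fps_const lam)
      (fps_bilinear_map (constant_series br)) (fps_linear_map (constant_series T))
      (fps_bilinear_map m) (fps_linear_map S) (fps_linear_map f)"
    by (intro rb_lie_algebra_morphism.intro rb_lie_algebra_morphism_axioms.intro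
        rb_lie_algebra_trivial_deformation target hom br ext) (simp add: op)
  with f f_0 show ?thesis
    unfolding equivalent_deformations_def by blast
qed

text \<open>
  The leading coefficients \<open>(E, G)\<close> of the two defects of an equivalence up to order \<open>n\<close> form a
  \<open>2\<close>-cocycle of the undeformed algebra: in the coefficient of \<open>t\<^sup>n\<close> of the defect identities, every
  bracket and operator applied to a defect is reduced modulo \<open>t\<close>, and the product of two operator
  defects has order at least \<open>2n > n\<close>. Adding a term \<open>t\<^sup>n k\<close> to the map adds the coboundary of \<open>k\<close>
  to \<open>(E, G)\<close>; so \<open>k = - h\<close> works if \<open>(E, G)\<close> is the coboundary of \<open>h\<close>.
\<close>

lemma extend_equivalence:
  assumes van: "rb_cohomology_vanishes scale br lam T 2"
    and n: "n > 0"
    and f: "\<And>i. module_hom scale scale (f i)" and f_0: "f 0 = id"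
    and f_trunc: "\<And>i. i \<ge> n \<Longrightarrow> f i = 0"
    and eqs: "\<And>k. k < n \<Longrightarrow> equivalence_at_order br T m S f k"
  obtains h where "module_hom scale scale h" and "equivalence_at_order br T m S (f(n := h)) n"
proof -
  interpret D: rb_linear_map "fps_scale scale" "fps_scale scale" "fps_const lam"
    "fps_bilinear_map (constant_series br)" "fps_linear_map (constant_series T)"
    "fps_bilinear_map m" "fps_linear_map S" "fps_linear_map f"
    by (rule rb_linear_map_series[OF f])
  interpret P: module_pair scale scale ..
  let ?M = "fps_bilinear_map m"
  define F where "F x = Abs_fps (\<lambda>i. f i x)" for x
  note f_const = fps_linear_map_const[of f, OF module_hom.zero[OF f], folded F_def]
  have F_0: "fps_nth (F x) 0 = x" and F_n: "fps_nth (F x) n = 0" for x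
    using f_0 f_trunc by (simp_all add: F_def)
  define A where "A x y = D.bracket_defect (fps_const x) (fps_const y)" for x y
  define B where "B x = D.operator_defect (fps_const x)" for x
  define E where "E x y = fps_nth (A x y) n" for x y
  define G where "G x = fps_nth (B x) n" for x
  have A: "A x y = ?M (F x) (F y) - F (br x y)" for x y
    by (simp add: A_def D.bracket_defect_def f_const fbr_const)
  have B: "B x = fps_linear_map S (F x) - F (T x)" for x
    by (simp add: B_def D.operator_defect_def f_const fT_const)
  have A_low: "fps_nth (A x y) k = 0" and B_low: "fps_nth (B x) k = 0" if "k < n" for x y k
    using eqs[OF that] by (simp_all add: A B equivalence_at_order_def F_def)
  have F_add: "F (x + y) = F x + F y" for x y
    by (simp add: F_def fps_eq_iff module_hom.add[OF f])
  have F_scale: "F (scale c x) = fps_scale scale (fps_const c) (F x)" for c x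
    by (simp add: F_def fps_eq_iff fps_scale_const module_hom.scale[OF f])
  have br_F: "fps_nth (?M (F x) u) n = br x (fps_nth u n)"
    "fps_nth (?M u (F x)) n = br (fps_nth u n) x" if "\<And>k. k < n \<Longrightarrow> fps_nth u k = 0" for x u
    using that by (simp_all add: fps_bilinear_map_leading_left[where m = m, OF m_zero(1)]
        fps_bilinear_map_leading_right[where m = m, OF m_zero(2)] m_0 F_0)
  have S_lead: "fps_nth (fps_linear_map S u) n = T (fps_nth u n)"
    if "\<And>k. k < n \<Longrightarrow> fps_nth u k = 0" for u
    using that by (simp add: fps_linear_map_leading S_zero S_0)
  have M_low: "fps_nth (?M u v) k = 0"
    if "\<And>k. k < n \<Longrightarrow> fps_nth u k = 0" "k < n" for u v k
    using that by (simp add: m_zero fps_bilinear_map_leading_left[where m = m, OF m_zero(1)])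
  have M_low': "fps_nth (?M u v) k = 0"
    if "\<And>k. k < n \<Longrightarrow> fps_nth v k = 0" "k < n" for u v k
    using that by (simp add: m_zero fps_bilinear_map_leading_right[where m = m, OF m_zero(2)])
  have E_alt: "alternating_bilinear scale E"
  proof -
    have E: "E x y = fps_nth (?M (F x) (F y)) n" for x y
      by (simp add: E_def A F_n)
    have "E x x = 0" for x
      by (simp add: E  D.target.br_self)
    moreover have "module_hom scale scale (E x)" for x
      by unfold_locales (simp_all add: E  F_add F_scale D.target.br_add_right
          D.target.br_scale_right fps_scale_const)
    moreover have "module_hom scale scale (\<lambda>x. E x y)" for y
      by unfold_locales (simp_all add: E  F_add F_scale D.target.br_add_left
          D.target.br_scale_left fps_scale_const)
    ultimately show ?thesis
      by (simp add: alternating_bilinear_def)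
  qed
  have G: "module_hom scale scale G"
    by unfold_locales (simp_all add: G_def B F_n F_add F_scale D.target.T_add
        D.target.T_scale fps_scale_const)
  have "E x (br y z) + E y (br z x) + E z (br x y)
      + (br x (E y z) + br y (E z x) + br z (E x y)) = 0" for x y z
    using arg_cong[OF D.bracket_defect_jacobi[of "fps_const x" "fps_const y" "fps_const z"],
        of "\<lambda>u. fps_nth u n"]
    by (simp add: fbr_const f_const flip: A_def) (simp add: br_F A_low flip: E_def)
  moreover have "E (T x) (T y) + br (G x) (T y) + br (T x) (G y) =
      G (descendant_bracket scale br lam T x y)
      + T (E (T x) y + E x (T y) + scale lam (E x y) + br (G x) y + br x (G y))" for x y
  proof -
    have d: "descendant_bracket (fps_scale scale) fbr (fps_const lam) fT (fps_const x) (fps_const y)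
        = fps_const (descendant_bracket scale br lam T x y)"
      by (simp add: descendant_bracket_def fbr_const fT_const flip: fps_const_scale)
    \<comment> \<open>As \<open>B x\<close> vanishes below order \<open>n\<close>, this coefficient is \<open>[G x, (B y)\<^sub>0]\<close>, and \<open>(B y)\<^sub>0 = 0\<close>.\<close>
    have "fps_nth (?M (B x) (B y)) n = 0"
      using n by (simp add: B_low fps_bilinear_map_leading_left[where m = m, OF m_zero(1)]
          m_zero)
    moreover have "fps_nth (fps_linear_map S (A (T x) y + A x (T y)
          + fps_scale scale (fps_const lam) (A x y) + ?M (B x) (F y) + ?M (F x) (B y))) n
        = T (E (T x) y + E x (T y) + scale lam (E x y) + br (G x) y + br x (G y))"
      by (subst S_lead) (simp_all add: A_low B_low M_low M_low' fps_scale_const br_F E_def G_def)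
    ultimately show ?thesis
      using arg_cong[OF D.operator_defect_rota_baxter[of "fps_const x" "fps_const y"],
          of "\<lambda>u. fps_nth u n"]
      by (simp add: d fT_const f_const flip: A_def B_def)
        (simp add: br_F B_low flip: E_def G_def)
  qed
  ultimately obtain h where h: "module_hom scale scale h"
    and E_h: "\<And>x y. E x y = br x (h y) + br (h x) y - h (br x y)"
    and G_h: "\<And>x. G x = T (h x) - h (T x)"
    using rb_2_cocycle_is_coboundary[OF van E_alt G] by blast
  let ?f = "f(n := \<lambda>x. - h x)"
  define H where "H x = Abs_fps (\<lambda>i. if i = n then - h x else 0)" for x
  have split: "Abs_fps (\<lambda>i. ?f i x) = F x + H x" for x
    using f_trunc by (auto simp: fps_eq_iff F_def H_def)
  have H_low: "fps_nth (H x) k = 0" if "k < n" for x k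
    using that by (simp add: H_def)
  have H_n: "fps_nth (H x) n = - h x" for x
    by (simp add: H_def)
  have "fps_nth (?M (F x + H x) (F y + H y)) n = - h (br x y)" for x y
  proof -
    have "fps_nth (?M (H x) (H y)) n = 0"
      using n by (simp add: H_low fps_bilinear_map_leading_left[where m = m, OF m_zero(1)]
          m_zero)
    moreover have "fps_nth (?M (F x) (F y)) n = E x y"
      by (simp add: E_def A F_n)
    moreover have "?M (F x + H x) (F y + H y)
        = ?M (F x) (F y) + ?M (F x) (H y) + ?M (H x) (F y) + ?M (H x) (H y)"
      by (simp add: D.target.br_add_left D.target.br_add_right)
    ultimately show ?thesis
      by (simp add: br_F H_low H_n E_h br_neg_left br_neg_right)
  qed
  moreover have "fps_nth (fps_linear_map S (F x + H x)) n = - h (T x)" for x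
  proof -
    have "fps_nth (fps_linear_map S (F x)) n = G x"
      by (simp add: G_def B F_n)
    then show ?thesis
      by (simp add: D.target.T_add S_lead H_low H_n G_h T_neg)
  qed
  ultimately have "equivalence_at_order br T m S ?f n"
    unfolding equivalence_at_order_def split by simp
  with P.module_hom_neg[OF h] show ?thesis
    by (rule that)
qed

lemma deformation_equivalent_to_trivial:
  assumes van: "rb_cohomology_vanishes scale br lam T 2"
  shows "equivalent_deformations scale lam m S (constant_series br) (constant_series T)"
proof -
  interpret P: module_pair scale scale ..
  \<comment> \<open>The choice at order \<open>n\<close> may refer to the coefficients below \<open>n\<close> only, hence the truncation.\<close>
  define trunc where
    "trunc f n r = (\<lambda>i. if i < n then f i else if i = n then r else 0)"
    for f :: "nat \<Rightarrow> 'a \<Rightarrow> 'a" and n r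
  define good where "good f n r \<longleftrightarrow> module_hom scale scale r \<and> (n = 0 \<longrightarrow> r = id)
      \<and> equivalence_at_order br T m S (trunc f n r) n" for f n r
  have trunc_cong: "trunc f n r = trunc g n r" if "\<And>k. k < n \<Longrightarrow> f k = g k" for f g n r
    using that by (auto simp: trunc_def)
  have good_iff: "good f n (f n) \<longleftrightarrow> module_hom scale scale (f n) \<and> (n = 0 \<longrightarrow> f n = id)
      \<and> equivalence_at_order br T m S f n" for f n
    unfolding good_def
    by (subst equivalence_at_order_cong[of n "trunc f n (f n)" f]) (auto simp: trunc_def)
  have "\<exists>f. \<forall>n. good f n (f n)"
  proof (rule dependent_wf_choice[OF wf_less_than])
    show "good f n r = good g n r" if "\<And>k. (k, n) \<in> less_than \<Longrightarrow> f k = g k" for f g n r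
      using that trunc_cong[of n f g r] by (simp add: good_def)
    show "\<exists>r. good f n r" if prev: "\<And>k. (k, n) \<in> less_than \<Longrightarrow> good f k (f k)" for f n
    proof (cases "n = 0")
      case True
      then have "good f n id"
        by (simp add: good_def trunc_def equivalence_at_order_0 module_hom_id)
      then show ?thesis by blast
    next
      case False
      let ?g = "trunc f n 0"
      have zero: "module_hom scale scale 0"
        using P.module_hom_zero by (simp add: zero_fun_def)
      have f: "module_hom scale scale (f k)" "k = 0 \<longrightarrow> f k = id"
        "equivalence_at_order br T m S f k" if "k < n" for k
        using prev[of k] that by (simp_all add: good_iff)
      obtain r where r: "module_hom scale scale r"
        "equivalence_at_order br T m S (?g(n := r)) n"
      proof (rule extend_equivalence[OF van, of n ?g])
        show "equivalence_at_order br T m S ?g k" if "k < n" for k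
          using f(3)[OF that] that
          by (subst equivalence_at_order_cong[of k ?g f]) (auto simp: trunc_def)
      qed (use False f zero in \<open>auto simp: trunc_def\<close>)
      moreover have "?g(n := r) = trunc f n r"
        by (auto simp: trunc_def)
      ultimately have "good f n r"
        using False by (simp add: good_def)
      then show ?thesis by blast
    qed
  qed
  then obtain f where "good f n (f n)" for n
    by blast
  then show ?thesis
    by (intro equivalent_to_trivial[of f]) (auto simp: good_iff)
qed

end

theorem theorem4p7:
  fixes scale :: "'k::field_char_0 \<Rightarrow> 'a::ab_group_add \<Rightarrow> 'a"
    and mu :: "'a \<Rightarrow> 'a \<Rightarrow> 'a"
    and lam :: 'k
    and T :: "'a \<Rightarrow> 'a"
  assumes "rb_lie_algebra scale mu lam T"
    and "rb_cohomology_vanishes scale mu lam T 2"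
  shows "\<forall>mu_t T_t. formal_deformation scale mu lam T mu_t T_t \<longrightarrow>
           equivalent_deformations scale lam mu_t T_t (constant_series mu) (constant_series T)"
  using assms by (blast intro: rb_deformation.deformation_equivalent_to_trivial
      rb_deformation.intro rb_deformation_axioms.intro)

end
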